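(* Let $X$ and $Y$ be shift spaces over a finite alphabet $\mathscr{A}$, both with the $\bar d$-shadowing property, and let $\varepsilon>0$ be such that $$\bar d^H_{\mathcal M}(\mathcal{M}_\sigma(X),\mathcal{M}_\sigma(Y))<\varepsilon^2.$$ Then $\bar d^H(X,Y)<7\varepsilon$.
   Context: Alphabet: $\mathscr{A}$ is a finite set with at least two elements. $\mathscr{A}^\infty$ is the set of sequences $x=(x_i)_{i\ge 0}$ with entries in $\mathscr{A}$, with the product topology; $\sigma(x)_j=x_{j+1}$. A shift space is a nonempty closed set $X\subseteq\mathscr{A}^\infty$ with $\sigma(X)\subseteq X$. $\mathcal{B}(X)$ is the set of all finite words appearing in elements of $X$. $\mathcal{M}_\sigma(\mathscr{A}^\infty)$ is the set of $\sigma$-invariant Borel probability measures on $\mathscr{A}^\infty$, and $\mathcal{M}_\sigma(X)$ is the subset of those with $\mu(X)=1$. Pointwise pseudometric: $\bar d(x,y)=\limsup_{n\to\infty}\frac1n|\{0\le j<n: x_j\ne y_j\}|$ for $x,y\in\mathscr{A}^\infty$. Ornstein metric: for $\mu,\nu\in\mathcal{M}_\sigma(\mathscr{A}^\infty)$, $\bar d_{\mathcal M}(\mu,\nu)=\inf_{\xi}\xi(\{(x,y): x_0\neq y_0\})$, the infimum over all $\sigma\times\sigma$-invariant Borel probability measures $\xi$ on $\mathscr{A}^\infty\times\mathscr{A}^\infty$ with marginals $\mu$ and $\nu$. For a bounded pseudometric $\rho$, the Hausdorff pseudometric on nonempty subsets is $\rho^H(A,B)=\max\{\sup_{a\in A}\inf_{b\in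 B}\rho(a,b),\sup_{b\in B}\inf_{a\in A}\rho(a,b)\}$; $\bar d^H$ and $\bar d^H_{\mathcal M}$ are those induced by $\bar d$ and $\bar d_{\mathcal M}$. $\bar d$-shadowing property of $X$: for every $\varepsilon>0$ there is $N\in\mathbb{N}$ such that for every sequence $(w^{(j)})_{j=1}^\infty$ of words in $\mathcal{B}(X)$ with $|w^{(j)}|\ge N$ for all $j$, there is $x'\in X$ with $\bar d(w^{(1)}w^{(2)}w^{(3)}\ldots,x')<\varepsilon$. *)

theory Defs
  imports "HOL-Probability.Probability"
begin

text \<open>
  The alphabet is a finite type with the discrete topology. The class only combines two library
  classes, so that sequences over the alphabet and pairs of such sequences carry the library's
  product topologies and Borel sigma-algebras.
\<close>

class finite_alphabet = finite + discrete_topology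

instance bool :: finite_alphabet ..

instance finite_alphabet \<subseteq> second_countable_topology
proof
  have "open U = generate_topology (UNIV :: 'a set set) U" for U
    using discrete_topology_class.open_discrete[of U] generate_topology.Basis[of U UNIV] by blast
  then have "countable (UNIV :: 'a set set) \<and> open = generate_topology (UNIV :: 'a set set)"
    by (auto intro: countable_finite)
  then show "\<exists>B :: 'a set set. countable B \<and> open = generate_topology B" ..
qed

definition shift_map :: "(nat \<Rightarrow> 'a) \<Rightarrow> nat \<Rightarrow> 'a" where
  "shift_map x = (\<lambda>j. x (Suc j))"

definition shift_space :: "(nat \<Rightarrow> 'a::finite_alphabet) set \<Rightarrow> bool" where
  "shift_space X \<longleftrightarrow> X \<noteq> {} \<and> closed X \<and> shift_map ` X \<subseteq> X"

definition language :: "(nat \<Rightarrow> 'a) set \<Rightarrow> 'a list set" where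
  "language X = {map x [i..<i + n] | x i n. x \<in> X}"

text \<open>
  All distances below are extended reals, so that \<open>limsup\<close>, \<open>SUP\<close> and \<open>INF\<close> are taken in a
  complete lattice.
\<close>

definition dbar :: "(nat \<Rightarrow> 'a) \<Rightarrow> (nat \<Rightarrow> 'a) \<Rightarrow> ereal" where
  "dbar x y = limsup (\<lambda>n. ereal (real (card {j. j < n \<and> x j \<noteq> y j}) / real n))"

definition invariant_measures :: "('b::topological_space \<Rightarrow> 'b) \<Rightarrow> 'b measure set" where
  "invariant_measures T = {\<mu>. prob_space \<mu> \<and> sets \<mu> = sets borel \<and> distr \<mu> borel T = \<mu>}"

definition shift_measures_on :: "(nat \<Rightarrow> 'a::finite_alphabet) set \<Rightarrow> (nat \<Rightarrow> 'a) measure set" where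
  "shift_measures_on X = {\<mu> \<in> invariant_measures shift_map. measure \<mu> X = 1}"

definition joinings ::
    "(nat \<Rightarrow> 'a::finite_alphabet) measure \<Rightarrow> (nat \<Rightarrow> 'a) measure
      \<Rightarrow> ((nat \<Rightarrow> 'a) \<times> (nat \<Rightarrow> 'a)) measure set" where
  "joinings \<mu> \<nu> = {\<xi> \<in> invariant_measures (map_prod shift_map shift_map).
      distr \<xi> borel fst = \<mu> \<and> distr \<xi> borel snd = \<nu>}"

definition dbar_M ::
    "(nat \<Rightarrow> 'a::finite_alphabet) measure \<Rightarrow> (nat \<Rightarrow> 'a) measure \<Rightarrow> ereal" where
  "dbar_M \<mu> \<nu> = (INF \<xi> \<in> joinings \<mu> \<nu>. ereal (measure \<xi> {(x, y). x 0 \<noteq> y 0}))"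

definition hausdorff :: "('b \<Rightarrow> 'b \<Rightarrow> ereal) \<Rightarrow> 'b set \<Rightarrow> 'b set \<Rightarrow> ereal" where
  "hausdorff \<rho> A B = max (SUP a\<in>A. INF b\<in>B. \<rho> a b) (SUP b\<in>B. INF a\<in>A. \<rho> a b)"

text \<open>
  The infinite concatenation \<open>w 0 @ w 1 @ w 2 @ \<dots>\<close> of nonempty words: its \<open>k\<close>-th letter lies within
  the first \<open>k + 1\<close> words. Meaningful only if all words are nonempty.
\<close>

definition infinite_concat :: "(nat \<Rightarrow> 'a list) \<Rightarrow> nat \<Rightarrow> 'a" where
  "infinite_concat w k = concat (map w [0..<Suc k]) ! k"

lemma infinite_concat_prefix:
  assumes nonempty: "\<And>j. w j \<noteq> []" and k: "k < length (concat (map w [0..<n]))"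
  shows "infinite_concat w k = concat (map w [0..<n]) ! k"
proof -
  have len: "m \<le> length (concat (map w [0..<m]))" for m
  proof (induction m)
    case (Suc m)
    have "Suc 0 \<le> length (w m)" using nonempty[of m] by (simp add: Suc_le_eq)
    moreover have "length (concat (map w [0..<Suc m])) = length (concat (map w [0..<m])) + length (w m)"
      by simp
    ultimately show ?case using Suc.IH by linarith
  qed auto
  have mono: "concat (map w [0..<n]) ! k = concat (map w [0..<m]) ! k"
    if "n \<le> m" "k < length (concat (map w [0..<n]))" for n m
  proof -
    have "[0..<m] = [0..<n] @ [n..<m]"
      using upt_add_eq_append[of 0 n "m - n"] that(1) by simp
    then show ?thesis using that(2) by (simp add: nth_append)
  qed
  have "k < length (concat (map w [0..<Suc k]))" using len[of "Suc k"] by simp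
  then show ?thesis
    unfolding infinite_concat_def using mono[OF _ k, of "Suc k"] mono[of "Suc k" n]
    by (metis nat_le_linear)
qed

text \<open>
  The bound \<open>N\<close> is taken positive so that the infinite concatenation is defined; enlarging \<open>N\<close>
  only weakens the requirement.
\<close>

definition dbar_shadowing :: "(nat \<Rightarrow> 'a) set \<Rightarrow> bool" where
  "dbar_shadowing X \<longleftrightarrow> (\<forall>\<epsilon>>0. \<exists>N\<ge>1. \<forall>w.
      (\<forall>j. w j \<in> language X \<and> N \<le> length (w j))
        \<longrightarrow> (\<exists>x'\<in>X. dbar (infinite_concat w) x' < ereal \<epsilon>))"

end

theory Submission
  imports Defs
begin

text \<open>
  By symmetry it is enough to approximate every \<open>x \<in> X\<close> by a point of \<open>Y\<close>. If \<open>\<epsilon> \<ge> 1/2\<close> this is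
  trivial, because \<open>dbar \<le> 1\<close>; so let \<open>\<epsilon> < 1/2\<close> and let \<open>n\<close> be a block length that the shadowing
  property of \<open>Y\<close> provides for the precision \<open>\<epsilon>\<close>.

  Call a sequence unmatched if no point of \<open>Y\<close> agrees with its first \<open>n\<close> letters up to \<open>\<epsilon> n\<close>
  mismatches. Every invariant measure \<open>\<mu>\<close> on \<open>X\<close> has a joining with an invariant measure on \<open>Y\<close>
  whose initial letters differ with probability less than \<open>\<epsilon>\<^sup>2\<close>; the expected number of mismatches
  in a block of length \<open>n\<close> is then less than \<open>\<epsilon>\<^sup>2 n\<close>, and Markov's inequality shows that the
  unmatched sequences have \<open>\<mu>\<close>-measure at most \<open>\<epsilon>\<close> (\<open>measure_unmatched_le\<close>).

  This estimate is uniform in \<open>\<mu>\<close>, so it passes from measures to the individual orbit of \<open>x\<close>,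
  generic or not: if the orbit visited the clopen set of unmatched sequences with upper frequency
  above \<open>2 \<epsilon>\<close>, then a limit of its empirical measures along suitable times would be an invariant
  measure on \<open>X\<close> giving that set too much mass (\<open>invariant_measure_with_visit_freq\<close>).

  Now parse \<open>x\<close> greedily from left to right: at a matched position start a block of length \<open>n\<close>, and
  between blocks skip the unmatched positions. No single residue class modulo \<open>n\<close> needs to be good
  at all times, which is what makes the argument work for points that are not generic. Replace
  each block by the start of a matching point of \<open>Y\<close>, and let that same point run on through the
  skipped positions; the result \<open>z\<close> is a concatenation of words of \<open>Y\<close> of length at least \<open>n\<close>. The
  blocks cost density at most \<open>\<epsilon>\<close> and the skipped positions at most \<open>2 \<epsilon>\<close>
  (\<open>mismatches_paste\<close>), with another \<open>\<epsilon>\<close> for the boundary effects. Shadowing gives a point of \<open>Y\<close>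
  within \<open>\<epsilon>\<close> of \<open>z\<close>, so the distance from \<open>x\<close> to \<open>Y\<close> is at most \<open>5 \<epsilon>\<close>.
\<close>

section \<open>Clopen sets of sequences and measures determined by them\<close>

lemma open_contains_cylinder:
  fixes U :: "(nat \<Rightarrow> 'a::topological_space) set"
  assumes "open U" "x \<in> U"
  obtains n where "{z. \<forall>i<n. z i = x i} \<subseteq> U"
proof -
  have "openin (product_topology (\<lambda>_. euclidean) UNIV) U"
    using assms(1) by (simp add: euclidean_product_topology)
  then obtain V where fin: "finite {i. V i \<noteq> UNIV}" and xV: "x \<in> Pi\<^sub>E UNIV V" and VU: "Pi\<^sub>E UNIV V \<subseteq> U"
    using assms(2) unfolding openin_product_topology_alt by force
  obtain n where n: "\<And>i. V i \<noteq> UNIV \<Longrightarrow> i < n"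
    using fin finite_nat_set_iff_bounded by auto
  have "{z. \<forall>i<n. z i = x i} \<subseteq> U"
  proof
    fix z assume z: "z \<in> {z. \<forall>i<n. z i = x i}"
    have "z i \<in> V i" for i
      using n[of i] z xV by (cases "V i = UNIV") (auto simp: PiE_UNIV_domain)
    then show "z \<in> U" using VU by auto
  qed
  then show thesis by (rule that)
qed

lemma open_if_depends_on_prefix:
  fixes A :: "(nat \<Rightarrow> 'a::discrete_topology) set"
  assumes "\<And>z z'. \<lbrakk>z \<in> A; \<forall>i<n. z' i = z i\<rbrakk> \<Longrightarrow> z' \<in> A"
  shows "open A"
proof -
  have cyl: "open {z. \<forall>i<n. z i = x i}" for x :: "nat \<Rightarrow> 'a"
  proof -
    have "open ((\<lambda>z. z i) -` {x i})" for i
      by (intro open_vimage discrete_topology_class.open_discrete) auto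
    then have "open (\<Inter>i<n. (\<lambda>z. z i) -` {x i})" by (intro open_INT) simp_all
    moreover have "(\<Inter>i<n. (\<lambda>z. z i) -` {x i}) = {z. \<forall>i<n. z i = x i}" by auto
    ultimately show ?thesis by simp
  qed
  have "A = (\<Union>x\<in>A. {z. \<forall>i<n. z i = x i})" using assms by blast
  then show ?thesis using open_UN[of A "\<lambda>x. {z. \<forall>i<n. z i = x i}"] cyl by simp
qed

lemma clopen_if_depends_on_prefix:
  fixes A :: "(nat \<Rightarrow> 'a::discrete_topology) set"
  assumes "\<And>z z'. \<forall>i<n. z' i = z i \<Longrightarrow> z' \<in> A \<longleftrightarrow> z \<in> A"
  shows "open A" "closed A"
proof -
  show "open A" using assms by (intro open_if_depends_on_prefix[of A n]) blast
  have "open (- A)" using assms by (intro open_if_depends_on_prefix[of "- A" n]) blast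
  then show "closed A" by (simp add: closed_def)
qed

text \<open>
  Over a discrete alphabet the points whose \<open>n\<close>-cylinder lies in \<open>U\<close> form a clopen set, and every
  point of an open set has a cylinder in it. Hence measures on sequences can be built from, and
  compared on, clopen sets alone.
\<close>

lemma open_eq_Union_clopen:
  fixes U :: "(nat \<Rightarrow> 'a::discrete_topology) set"
  assumes "open U"
  obtains V where "\<forall>n::nat. open (V n) \<and> closed (V n)" "U = (\<Union>n. V n)"
proof -
  define V where "V n = {x. {z. \<forall>i<n. z i = x i} \<subseteq> U}" for n :: nat
  have *: "x \<in> V n \<longleftrightarrow> y \<in> V n" if "\<forall>i<n. x i = y i" for x y n
    using that by (simp add: V_def)
  have "open (V n)" "closed (V n)" for n
    by (rule clopen_if_depends_on_prefix[where n = n], rule *, simp)+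
  then have "\<forall>n. open (V n) \<and> closed (V n)" by simp
  moreover have "U = (\<Union>n. V n)"
  proof (intro subset_antisym subsetI)
    fix x assume "x \<in> U"
    then obtain n where "{z. \<forall>i<n. z i = x i} \<subseteq> U" by (rule open_contains_cylinder[OF assms])
    then show "x \<in> (\<Union>n. V n)" unfolding V_def by blast
  qed (auto simp: V_def)
  ultimately show thesis by (rule that)
qed

lemma sigma_sets_clopen:
  "sigma_sets UNIV {A :: (nat \<Rightarrow> 'a::discrete_topology) set. open A \<and> closed A} = sets borel"
  (is "sigma_sets UNIV ?C = _")
proof -
  have "sigma_sets UNIV {S :: (nat \<Rightarrow> 'a) set. open S} = sigma_sets UNIV ?C"
  proof (rule sigma_sets_eqI)
    fix U :: "(nat \<Rightarrow> 'a) set" assume "U \<in> {S. open S}"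
    then have "open U" by simp
    then obtain V where V: "\<forall>n::nat. open (V n) \<and> closed (V n)" and U: "U = (\<Union>n. V n)"
      by (rule open_eq_Union_clopen)
    show "U \<in> sigma_sets UNIV ?C"
      unfolding U by (rule sigma_sets.Union, rule sigma_sets.Basic) (simp add: V)
  qed auto
  then show ?thesis by (simp add: borel_def)
qed

lemma compact_sequences: "compact (UNIV :: (nat \<Rightarrow> 'a::finite_alphabet) set)"
proof -
  have "compact (UNIV :: 'a set)" by (simp add: finite_imp_compact)
  then have "compactin (product_topology (\<lambda>_. euclidean) UNIV) (PiE (UNIV :: nat set) (\<lambda>_. UNIV :: 'a set))"
    by (subst compactin_PiE) auto
  then show ?thesis by (simp add: euclidean_product_topology PiE_UNIV_domain Pi_UNIV)
qed

text \<open>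
  Compactness makes countable additivity free: a decreasing sequence of clopen sets with empty
  intersection is empty from some index on, so Caratheodory's theorem applies to every finitely
  additive content. The hypotheses are stated for all sets because the contents used below are
  limits of visit frequencies.
\<close>

lemma clopen_content_extends:
  fixes L :: "(nat \<Rightarrow> 'a::finite_alphabet) set \<Rightarrow> real"
  assumes nonneg: "\<And>A. 0 \<le> L A" and univ: "L UNIV = 1"
    and add: "\<And>A B. A \<inter> B = {} \<Longrightarrow> L (A \<union> B) = L A + L B"
  obtains \<mu> where "prob_space \<mu>" "sets \<mu> = sets borel"
    "\<And>A. open A \<Longrightarrow> closed A \<Longrightarrow> measure \<mu> A = L A"
proof -
  define C where "C = {A :: (nat \<Rightarrow> 'a) set. open A \<and> closed A}"
  have empty: "L {} = 0" using add[of "{}" "{}"] by simp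
  interpret ring_of_sets UNIV C
    by (rule ring_of_setsI) (auto simp: C_def open_Diff closed_Diff)
  have "\<exists>\<mu>. (\<forall>A\<in>C. \<mu> A = ennreal (L A)) \<and> measure_space UNIV (sigma_sets UNIV C) \<mu>"
  proof (rule caratheodory_empty_continuous)
    show "positive C (\<lambda>A. ennreal (L A))" by (simp add: positive_def empty)
    show "additive C (\<lambda>A. ennreal (L A))"
      by (auto simp: additive_def add nonneg)
    fix A :: "nat \<Rightarrow> (nat \<Rightarrow> 'a) set"
    assume A: "range A \<subseteq> C" "decseq A" "(\<Inter>i. A i) = {}"
    have "open (- A i)" for i using A(1) by (auto simp: C_def)
    moreover have "UNIV \<subseteq> (\<Union>i. - A i)" using A(3) by auto
    ultimately obtain I where I: "finite I" "UNIV \<subseteq> (\<Union>i\<in>I. - A i)"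
      by (rule compactE_image[OF compact_sequences, of UNIV "\<lambda>i. - A i"])
    obtain m0 where m0: "\<forall>i\<in>I. i \<le> m0"
      using I(1) finite_nat_set_iff_bounded_le by auto
    have "A m = {}" if "m0 \<le> m" for m
    proof -
      have "A m \<subseteq> - (\<Union>i\<in>I. - A i)"
      proof
        fix z assume z: "z \<in> A m"
        have "z \<in> A i" if "i \<in> I" for i
          using decseqD[OF A(2), of i m] m0 that z \<open>m0 \<le> m\<close> by (meson order_trans subsetD)
        then show "z \<in> - (\<Union>i\<in>I. - A i)" by simp
      qed
      also have "- (\<Union>i\<in>I. - A i) = {}" using I(2) by blast
      finally show ?thesis by simp
    qed
    then have "\<forall>\<^sub>F m in sequentially. ennreal (L (A m)) = 0"
      by (intro eventually_sequentiallyI[of m0]) (simp add: empty)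
    then show "(\<lambda>i. ennreal (L (A i))) \<longlonglongrightarrow> 0" by (rule tendsto_eventually)
  qed simp
  then obtain \<mu>0 where \<mu>0: "\<And>A. A \<in> C \<Longrightarrow> \<mu>0 A = ennreal (L A)"
    and ms: "measure_space UNIV (sigma_sets UNIV C) \<mu>0" by blast
  define \<mu> where "\<mu> = measure_of UNIV C \<mu>0"
  have sets: "sets \<mu> = sets borel"
    unfolding \<mu>_def C_def by (simp add: sigma_sets_clopen)
  have em: "emeasure \<mu> A = ennreal (L A)" if "A \<in> C" for A
  proof -
    have "emeasure \<mu> A = \<mu>0 A"
      by (rule emeasure_measure_of[OF \<mu>_def])
        (use ms that in \<open>auto simp: measure_space_def \<mu>_def\<close>)
    then show ?thesis using \<mu>0[OF that] by simp
  qed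
  have "prob_space \<mu>"
  proof
    have "space \<mu> = UNIV" unfolding \<mu>_def by simp
    then show "emeasure \<mu> (space \<mu>) = 1" using em[of UNIV] univ by (simp add: C_def)
  qed
  moreover have "measure \<mu> A = L A" if "open A" "closed A" for A
    using em[of A] that nonneg by (simp add: C_def measure_def)
  ultimately show thesis using sets that by blast
qed

lemma borel_measure_eqI_clopen:
  fixes \<mu> \<nu> :: "(nat \<Rightarrow> 'a::discrete_topology) measure"
  assumes "prob_space \<mu>" "prob_space \<nu>" "sets \<mu> = sets borel" "sets \<nu> = sets borel"
    and eq: "\<And>A. open A \<Longrightarrow> closed A \<Longrightarrow> measure \<mu> A = measure \<nu> A"
  shows "\<mu> = \<nu>"
proof -
  interpret \<mu>: prob_space \<mu> by fact
  interpret \<nu>: prob_space \<nu> by fact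
  show ?thesis
  proof (rule measure_eqI_generator_eq[where \<Omega> = UNIV and A = "\<lambda>_. UNIV"])
    show "Int_stable {A :: (nat \<Rightarrow> 'a) set. open A \<and> closed A}" by (auto simp: Int_stable_def)
  qed (auto simp: assms sigma_sets_clopen \<mu>.emeasure_eq_measure \<nu>.emeasure_eq_measure)
qed

text \<open>
  Tychonoff's theorem for \<open>[0, 1]\<close> raised to an arbitrary index set: one refinement of the filter
  makes all members of the family converge at once. With filters in place of subsequences the
  index set may be uncountable.
\<close>

lemma bounded_family_converges_along_subfilter:
  fixes f :: "'i \<Rightarrow> 'j \<Rightarrow> real"
  assumes "F \<noteq> bot" and bounded: "\<And>i n. f i n \<in> {0..1}"
  obtains L G where "G \<noteq> bot" "G \<le> F" "\<And>i. (f i \<longlongrightarrow> L i) G"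
proof -
  define \<phi> where "\<phi> n = (\<lambda>i. f i n)" for n
  define K where "K = PiE (UNIV :: 'i set) (\<lambda>_. {0..1::real})"
  have "compactin (product_topology (\<lambda>_. euclidean) UNIV) K"
    unfolding K_def by (subst compactin_PiE) auto
  then have "compact K" by (simp add: euclidean_product_topology)
  moreover have "eventually (\<lambda>l. l \<in> K) (filtermap \<phi> F)"
    using bounded by (auto simp: eventually_filtermap K_def \<phi>_def PiE_UNIV_domain)
  moreover have "filtermap \<phi> F \<noteq> bot" using assms(1) by (simp add: filtermap_bot_iff)
  ultimately have "\<exists>L\<in>K. inf (nhds L) (filtermap \<phi> F) \<noteq> bot"
    by (metis compact_filter)
  then obtain L where L: "inf (nhds L) (filtermap \<phi> F) \<noteq> bot" by (elim bexE)
  define G where "G = inf F (filtercomap \<phi> (nhds L))"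
  have "G \<noteq> bot"
  proof
    assume "G = bot"
    then have "eventually (\<lambda>_. False) G" by simp
    then obtain P Q where PQ: "eventually P F" "eventually Q (filtercomap \<phi> (nhds L))"
      "\<And>n. P n \<Longrightarrow> Q n \<Longrightarrow> False" unfolding G_def eventually_inf by blast
    then obtain R where R: "eventually R (nhds L)" "\<And>n. R (\<phi> n) \<Longrightarrow> Q n"
      unfolding eventually_filtercomap by blast
    have "eventually (\<lambda>l. \<not> R l) (filtermap \<phi> F)"
      unfolding eventually_filtermap using PQ(1) by (rule eventually_mono) (use PQ R in blast)
    then have "eventually (\<lambda>_. False) (inf (nhds L) (filtermap \<phi> F))"
      unfolding eventually_inf using R(1) by blast
    then show False using L by (simp add: trivial_limit_def)
  qed
  moreover have "G \<le> F" unfolding G_def by simp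
  moreover have "(f i \<longlongrightarrow> L i) G" for i
  proof -
    have "(\<phi> \<longlongrightarrow> L) (filtercomap \<phi> (nhds L))" by (rule filterlim_filtercomap)
    then have lim: "(\<phi> \<longlongrightarrow> L) G" unfolding G_def by (rule filterlim_mono) auto
    have "continuous_on UNIV (\<lambda>l :: 'i \<Rightarrow> real. l i)" by simp
    from continuous_on_tendsto_compose[OF this lim] show ?thesis by (simp add: \<phi>_def)
  qed
  ultimately show thesis by (rule that)
qed

section \<open>Invariant measures from visit frequencies\<close>

definition visit_freq :: "(nat \<Rightarrow> 'a) \<Rightarrow> (nat \<Rightarrow> 'a) set \<Rightarrow> nat \<Rightarrow> real" where
  "visit_freq x A n = (\<Sum>t<n. indicat_real A (\<lambda>j. x (t + j))) / real n"

lemma visit_freq_bounds: "visit_freq x A n \<in> {0..1}"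
proof -
  have "(\<Sum>t<n. indicat_real A (\<lambda>j. x (t + j))) \<le> (\<Sum>t<n. 1)"
    by (intro sum_mono) (simp add: indicator_def)
  then show ?thesis
    unfolding visit_freq_def by (auto intro!: divide_nonneg_nonneg sum_nonneg simp: divide_simps)
qed

lemma visit_freq_UNIV: "0 < n \<Longrightarrow> visit_freq x UNIV n = 1"
  by (simp add: visit_freq_def)

lemma visit_freq_Un:
  assumes "A \<inter> B = {}"
  shows "visit_freq x (A \<union> B) n = visit_freq x A n + visit_freq x B n"
proof -
  have "indicat_real (A \<union> B) z = indicat_real A z + indicat_real B z" for z
    using assms by (auto simp: indicator_def)
  then show ?thesis by (simp add: visit_freq_def sum.distrib add_divide_distrib)
qed

text \<open>
  The two sums telescope up to one boundary term, so every limit of visit frequencies is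
  shift-invariant.
\<close>

lemma visit_freq_shift_vimage:
  "visit_freq x (shift_map -` A) n =
    visit_freq x A n + (indicat_real A (\<lambda>j. x (n + j)) - indicat_real A x) / real n"
proof -
  have "(\<Sum>t<n. indicat_real (shift_map -` A) (\<lambda>j. x (t + j))) =
      (\<Sum>t<n. indicat_real A (\<lambda>j. x (Suc t + j)))"
    by (intro sum.cong) (auto simp: indicator_def shift_map_def)
  also have "\<dots> = (\<Sum>t<n. indicat_real A (\<lambda>j. x (t + j))) +
      (indicat_real A (\<lambda>j. x (n + j)) - indicat_real A x)"
    using sum.lessThan_Suc_shift[of "\<lambda>t. indicat_real A (\<lambda>j. x (t + j))" n]
    by (simp add: sum.lessThan_Suc)
  finally show ?thesis unfolding visit_freq_def by (simp add: add_divide_distrib)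
qed

lemma continuous_on_shift_map: "continuous_on UNIV (shift_map :: (nat \<Rightarrow> 'a::topological_space) \<Rightarrow> _)"
  unfolding shift_map_def by (intro continuous_on_coordinatewise_then_product) simp

lemma suffix_in_shift_space: "shift_space X \<Longrightarrow> x \<in> X \<Longrightarrow> (\<lambda>j. x (t + j)) \<in> X"
proof (induction t)
  case (Suc t)
  then have "shift_map (\<lambda>j. x (t + j)) \<in> X" by (auto simp: shift_space_def)
  then show ?case by (simp add: shift_map_def)
qed simp

text \<open>
  Krylov and Bogoliubov's construction. The limit of the visit frequencies of \<open>x\<close>, taken along times
  at which \<open>B\<close> has been visited with frequency at least \<open>c\<close>, is a finitely additive invariant content
  and extends from the clopen sets to a measure. It lives on \<open>X\<close> because the orbit of \<open>x\<close> never leaves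
  \<open>X\<close>: the complement of \<open>X\<close> is a countable union of clopen sets that are never visited.
\<close>

lemma invariant_measure_with_visit_freq:
  fixes X :: "(nat \<Rightarrow> 'a::finite_alphabet) set"
  assumes X: "shift_space X" "x \<in> X" and B: "open B" "closed B"
    and freq: "\<exists>\<^sub>F n in sequentially. c \<le> visit_freq x B n"
  obtains \<mu> where "\<mu> \<in> shift_measures_on X" "c \<le> measure \<mu> B"
proof -
  \<comment> \<open>Restricting to the times with many visits keeps the lower bound \<open>c\<close> in the limit.\<close>
  define F where "F = inf sequentially (principal {n. c \<le> visit_freq x B n})"
  have "F \<noteq> bot"
    using freq unfolding F_def trivial_limit_def eventually_inf_principal frequently_def by simp
  then obtain L G where G: "G \<noteq> bot" "G \<le> F" and lim: "\<And>A. (visit_freq x A \<longlongrightarrow> L A) G"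
    using bounded_family_converges_along_subfilter[of F "visit_freq x"] visit_freq_bounds by metis
  have G_seq: "G \<le> sequentially" using G(2) unfolding F_def by simp
  have L_const: "L A = r" if "\<forall>\<^sub>F n in sequentially. visit_freq x A n = r" for A r
    using tendsto_unique[OF G(1) lim tendsto_eventually] filter_leD[OF G_seq that] by blast
  have nonneg: "0 \<le> L A" for A
    using visit_freq_bounds
    by (intro tendsto_lowerbound[OF lim always_eventually G(1)]) auto
  have univ: "L UNIV = 1"
    by (intro L_const eventually_mono[OF eventually_gt_at_top[of 0]]) (rule visit_freq_UNIV)
  have add: "L (A \<union> A') = L A + L A'" if "A \<inter> A' = {}" for A A'
    using lim[of "A \<union> A'"] tendsto_add[OF lim lim, of A A']
    unfolding visit_freq_Un[OF that] by (rule tendsto_unique[OF G(1)])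
  have shift: "L (shift_map -` A) = L A" for A
  proof -
    have "(\<lambda>n. (indicat_real A (\<lambda>j. x (n + j)) - indicat_real A x) / real n) \<longlonglongrightarrow> 0"
      by (rule Lim_null_comparison[OF always_eventually lim_1_over_n]) (auto simp: indicator_def)
    from tendsto_mono[OF G_seq this]
    have "(visit_freq x (shift_map -` A) \<longlongrightarrow> L A + 0) G"
      unfolding visit_freq_shift_vimage by (rule tendsto_add[OF lim])
    then show ?thesis using tendsto_unique[OF G(1) lim] by simp
  qed
  have "\<forall>\<^sub>F n in F. c \<le> visit_freq x B n"
    unfolding F_def eventually_inf_principal by simp
  then have LB: "c \<le> L B"
    using tendsto_lowerbound[OF lim _ G(1)] filter_leD[OF G(2)] by blast
  obtain \<mu> where \<mu>: "prob_space \<mu>" "sets \<mu> = sets borel"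
    and \<mu>L: "\<And>A. open A \<Longrightarrow> closed A \<Longrightarrow> measure \<mu> A = L A"
    using clopen_content_extends[OF nonneg univ add] by metis
  interpret prob_space \<mu> by fact
  have space: "space \<mu> = UNIV" using sets_eq_imp_space_eq[OF \<mu>(2)] by simp
  have meas: "shift_map \<in> measurable \<mu> borel"
    using borel_measurable_continuous_onI[OF continuous_on_shift_map]
    by (simp add: measurable_cong_sets[OF \<mu>(2) refl])
  have "distr \<mu> borel shift_map = \<mu>"
  proof (rule borel_measure_eqI_clopen)
    show "prob_space (distr \<mu> borel shift_map)" using meas by (rule prob_space_distr)
    fix A :: "(nat \<Rightarrow> 'a) set" assume A: "open A" "closed A"
    have "measure (distr \<mu> borel shift_map) A = measure \<mu> (shift_map -` A)"
      using A(1) by (simp add: measure_distr[OF meas] space)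
    also have "\<dots> = L (shift_map -` A)"
      using A by (intro \<mu>L open_vimage closed_vimage continuous_on_shift_map)
    finally show "measure (distr \<mu> borel shift_map) A = measure \<mu> A"
      using A by (simp add: shift \<mu>L)
  qed (use \<mu> in auto)
  moreover have "measure \<mu> X = 1"
  proof -
    have "closed X" using X(1) by (simp add: shift_space_def)
    then obtain V where V: "\<forall>n::nat. open (V n) \<and> closed (V n)" and cX: "- X = (\<Union>n. V n)"
      by (rule open_eq_Union_clopen[OF open_Compl])
    have "visit_freq x (V n) m = 0" for n m
    proof -
      have "(\<lambda>j. x (t + j)) \<notin> V n" for t
        using suffix_in_shift_space[OF X, of t] cX by auto
      then show ?thesis by (simp add: visit_freq_def)
    qed
    then have "measure \<mu> (V n) = 0" for n
      using V by (simp add: \<mu>L L_const)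
    then have "emeasure \<mu> (\<Union>n. V n) = 0"
      using V by (intro emeasure_UN_eq_0) (auto simp: emeasure_eq_measure \<mu>(2))
    then have "measure \<mu> (- X) = 0" by (simp add: cX measure_def)
    then show ?thesis
      using prob_compl[of X] \<open>closed X\<close> by (simp add: \<mu>(2) space Compl_eq_Diff_UNIV)
  qed
  ultimately have "\<mu> \<in> shift_measures_on X"
    using \<mu> by (simp add: shift_measures_on_def invariant_measures_def)
  moreover have "c \<le> measure \<mu> B" using LB \<mu>L[OF B] by simp
  ultimately show thesis by (rule that)
qed

section \<open>Block mismatches under joinings\<close>

definition mismatches :: "(nat \<Rightarrow> 'a) \<Rightarrow> (nat \<Rightarrow> 'a) \<Rightarrow> nat \<Rightarrow> nat" where
  "mismatches x y n = card {j. j < n \<and> x j \<noteq> y j}"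

lemma mismatches_0 [simp]: "mismatches x y 0 = 0"
  by (simp add: mismatches_def)

lemma mismatches_Suc: "mismatches x y (Suc n) = mismatches x y n + of_bool (x n \<noteq> y n)"
proof -
  have "{j. j < Suc n \<and> x j \<noteq> y j} =
      (if x n \<noteq> y n then insert n {j. j < n \<and> x j \<noteq> y j} else {j. j < n \<and> x j \<noteq> y j})"
    by (auto simp: less_Suc_eq)
  then show ?thesis by (simp add: mismatches_def)
qed

lemma mismatches_eq_sum: "mismatches x y n = (\<Sum>i<n. of_bool (x i \<noteq> y i))"
  by (induction n) (simp_all add: mismatches_Suc)

lemma mismatches_le: "mismatches x y n \<le> n"
  by (induction n) (auto simp: mismatches_Suc)

lemma mismatches_commute: "mismatches x y n = mismatches y x n"
  unfolding mismatches_def by metis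

lemma mismatches_triangle: "mismatches x z n \<le> mismatches x y n + mismatches y z n"
  by (induction n) (auto simp: mismatches_Suc)

definition unmatched :: "(nat \<Rightarrow> 'a) set \<Rightarrow> real \<Rightarrow> nat \<Rightarrow> (nat \<Rightarrow> 'a) set" where
  "unmatched Y e n = {z. \<forall>y\<in>Y. e * real n < real (mismatches z y n)}"

lemma clopen_unmatched:
  fixes Y :: "(nat \<Rightarrow> 'a::discrete_topology) set"
  shows "open (unmatched Y e n)" "closed (unmatched Y e n)"
proof -
  have *: "z' \<in> unmatched Y e n \<longleftrightarrow> z \<in> unmatched Y e n" if "\<forall>i<n. z' i = z i" for z z'
  proof -
    have "mismatches z' y n = mismatches z y n" for y
      using that by (simp add: mismatches_eq_sum)
    then show ?thesis by (simp add: unmatched_def)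
  qed
  show "open (unmatched Y e n)" "closed (unmatched Y e n)"
    by (rule clopen_if_depends_on_prefix[where n = n], rule *, simp)+
qed

lemma continuous_on_pair_coordinate:
  "continuous_on UNIV (\<lambda>p :: ('i \<Rightarrow> 'a::topological_space) \<times> ('j \<Rightarrow> 'b::topological_space). fst p i)"
  "continuous_on UNIV (\<lambda>p :: ('i \<Rightarrow> 'a) \<times> ('j \<Rightarrow> 'b). snd p j)"
  by (rule continuous_on_product_then_coordinatewise, intro continuous_intros)+

lemma continuous_on_map_prod_shift:
  "continuous_on UNIV (map_prod shift_map shift_map ::
      (nat \<Rightarrow> 'a::topological_space) \<times> (nat \<Rightarrow> 'b::topological_space) \<Rightarrow> _)"
  unfolding map_prod_def split_beta shift_map_def
  by (intro continuous_on_Pair continuous_on_coordinatewise_then_product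
      continuous_on_pair_coordinate)

lemma borel_mismatch:
  "{p :: (nat \<Rightarrow> 'a::t2_space) \<times> (nat \<Rightarrow> 'a). fst p i \<noteq> snd p i} \<in> sets borel"
  by (intro borel_open open_Collect_neq continuous_on_pair_coordinate)

text \<open>
  By invariance all coordinates differ with the same probability, so the expected number of
  mismatches among the first \<open>n\<close> letters is \<open>n\<close> times the probability of a mismatch at \<open>0\<close>.
\<close>

lemma joining_mismatches_Markov:
  fixes \<xi> :: "((nat \<Rightarrow> 'a::finite_alphabet) \<times> (nat \<Rightarrow> 'a)) measure"
  assumes \<xi>: "\<xi> \<in> invariant_measures (map_prod shift_map shift_map)" and "0 < e" "0 < n"
  shows "measure \<xi> {p. e * real n \<le> real (mismatches (fst p) (snd p) n)} \<le>
    measure \<xi> {(x, y). x 0 \<noteq> y 0} / e"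
proof -
  interpret prob_space \<xi> using \<xi> by (simp add: invariant_measures_def)
  have sets: "sets \<xi> = sets borel" and inv: "distr \<xi> borel (map_prod shift_map shift_map) = \<xi>"
    using \<xi> by (simp_all add: invariant_measures_def)
  have space: "space \<xi> = UNIV" using sets_eq_imp_space_eq[OF sets] by simp
  define D where "D i = {p :: (nat \<Rightarrow> 'a) \<times> (nat \<Rightarrow> 'a). fst p i \<noteq> snd p i}" for i
  have D_sets: "D i \<in> sets \<xi>" for i unfolding D_def sets by (rule borel_mismatch)
  have meas: "map_prod shift_map shift_map \<in> measurable \<xi> borel"
    using borel_measurable_continuous_onI[OF continuous_on_map_prod_shift]
    by (simp add: measurable_cong_sets[OF sets refl])
  have D_prob: "prob (D i) = prob (D 0)" for i
  proof (induction i)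
    case (Suc i)
    have "prob (D i) = measure (distr \<xi> borel (map_prod shift_map shift_map)) (D i)"
      by (simp add: inv)
    also have "\<dots> = prob (map_prod shift_map shift_map -` D i)"
      using D_sets by (subst measure_distr[OF meas]) (simp_all add: sets space)
    also have "map_prod shift_map shift_map -` D i = D (Suc i)"
      by (auto simp: D_def shift_map_def)
    finally show ?case using Suc.IH by simp
  qed simp
  have sum: "real (mismatches (fst p) (snd p) n) = (\<Sum>i<n. indicat_real (D i) p)" for p
    by (auto simp: mismatches_eq_sum D_def indicator_def intro!: sum.cong)
  have int: "integrable \<xi> (\<lambda>p. \<Sum>i<n. indicat_real (D i) p)"
    using D_sets by (intro Bochner_Integration.integrable_sum integrable_real_indicator)
      (auto simp: emeasure_eq_measure)
  have "measure \<xi> {p \<in> space \<xi>. e * real n \<le> (\<Sum>i<n. indicat_real (D i) p)} \<le>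
      (\<integral>p. (\<Sum>i<n. indicat_real (D i) p) \<partial>\<xi>) / (e * real n)"
    using assms by (intro integral_Markov_inequality_measure[OF int sets.top])
      (auto intro!: sum_nonneg)
  also have "(\<integral>p. (\<Sum>i<n. indicat_real (D i) p) \<partial>\<xi>) = (\<Sum>i<n. prob (D i))"
    using D_sets by (subst Bochner_Integration.integral_sum)
      (auto simp: emeasure_eq_measure intro!: integrable_real_indicator)
  also have "\<dots> = real n * prob (D 0)" by (subst sum.cong[OF refl D_prob]) simp
  finally have "measure \<xi> {p. e * real n \<le> real (mismatches (fst p) (snd p) n)} \<le>
      real n * prob (D 0) / (e * real n)"
    by (simp only: space sum UNIV_I simp_thms)
  also have "\<dots> = prob (D 0) / e" using \<open>0 < n\<close> by simp
  finally show ?thesis by (simp add: D_def case_prod_unfold)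
qed

text \<open>
  The second component of a joining lies in \<open>Y\<close> almost surely, so if the first component is unmatched
  then the two differ in more than \<open>e n\<close> of the first \<open>n\<close> letters. A mismatch probability below \<open>e\<^sup>2\<close>
  thus leaves measure at most \<open>e\<^sup>2 / e\<close>. The bound is the same for all \<open>\<mu>\<close>.
\<close>

lemma measure_unmatched_le:
  fixes X Y :: "(nat \<Rightarrow> 'a::finite_alphabet) set"
  assumes Y: "closed Y" and \<nu>: "\<nu> \<in> shift_measures_on Y"
    and less: "dbar_M \<mu> \<nu> < ereal (e\<^sup>2)" and "0 < e" "0 < n"
  shows "measure \<mu> (unmatched Y e n) \<le> e"
proof -
  obtain \<xi> where \<xi>: "\<xi> \<in> joinings \<mu> \<nu>" and \<xi>0: "measure \<xi> {(x, y). x 0 \<noteq> y 0} < e\<^sup>2"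
    using less unfolding dbar_M_def INF_less_iff by auto
  have inv: "\<xi> \<in> invariant_measures (map_prod shift_map shift_map)"
    and fst: "distr \<xi> borel fst = \<mu>" and snd: "distr \<xi> borel snd = \<nu>"
    using \<xi> by (auto simp: joinings_def)
  interpret prob_space \<xi> using inv by (simp add: invariant_measures_def)
  have sets: "sets \<xi> = sets borel" using inv by (simp add: invariant_measures_def)
  have space: "space \<xi> = UNIV" using sets_eq_imp_space_eq[OF sets] by simp
  have cont: "continuous_on UNIV (fst :: (nat \<Rightarrow> 'a) \<times> (nat \<Rightarrow> 'a) \<Rightarrow> _)"
    "continuous_on UNIV (snd :: (nat \<Rightarrow> 'a) \<times> (nat \<Rightarrow> 'a) \<Rightarrow> _)"
    by (intro continuous_intros)+
  have meas: "fst \<in> measurable \<xi> borel" "snd \<in> measurable \<xi> borel"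
    using borel_measurable_continuous_onI[OF cont(1)] borel_measurable_continuous_onI[OF cont(2)]
    by (simp_all add: measurable_cong_sets[OF sets refl])
  have "prob (snd -` Y) = 1"
    using \<nu> Y by (simp add: shift_measures_on_def measure_distr[OF meas(2)] space flip: snd)
  moreover have "snd -` Y \<in> sets \<xi>"
    using measurable_sets[OF meas(2), of Y] Y by (simp add: space)
  ultimately have AE_Y: "AE p in \<xi>. snd p \<in> Y"
    using AE_in_set_eq_1[of "snd -` Y"] by simp
  have event: "{p. e * real n \<le> real (mismatches (fst p) (snd p) n)} \<in> sets \<xi>"
  proof -
    have "(\<lambda>p. \<Sum>i<n. indicat_real {p :: (nat \<Rightarrow> 'a) \<times> (nat \<Rightarrow> 'a). fst p i \<noteq> snd p i} p)
        \<in> borel_measurable \<xi>"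
      by (intro borel_measurable_sum borel_measurable_indicator)
        (simp add: sets borel_mismatch)
    moreover have "(\<Sum>i<n. indicat_real {p. fst p i \<noteq> snd p i} p) =
        real (mismatches (fst p) (snd p) n)" for p :: "(nat \<Rightarrow> 'a) \<times> (nat \<Rightarrow> 'a)"
      by (auto simp: mismatches_eq_sum indicator_def intro!: sum.cong)
    ultimately have "(\<lambda>p. real (mismatches (fst p) (snd p) n)) \<in> borel_measurable \<xi>" by simp
    from borel_measurable_le[OF borel_measurable_const this, of "e * real n"]
    show ?thesis by (simp add: space)
  qed
  have "measure \<mu> (unmatched Y e n) = prob (fst -` unmatched Y e n)"
    using clopen_unmatched[of Y e n]
    by (simp add: measure_distr[OF meas(1)] space flip: fst)
  also have "\<dots> \<le> prob {p. e * real n \<le> real (mismatches (fst p) (snd p) n)}"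
  proof (rule finite_measure_mono_AE[OF _ event])
    have "e * real n \<le> real (mismatches (fst p) (snd p) n)"
      if "snd p \<in> Y" "fst p \<in> unmatched Y e n" for p
      using that by (simp add: unmatched_def less_imp_le)
    then show "AE p in \<xi>. p \<in> fst -` unmatched Y e n \<longrightarrow>
        p \<in> {p. e * real n \<le> real (mismatches (fst p) (snd p) n)}"
      using AE_Y by (intro eventually_mono[OF AE_Y]) simp
  qed
  also have "\<dots> \<le> prob {(x, y). x 0 \<noteq> y 0} / e"
    using inv \<open>0 < e\<close> \<open>0 < n\<close> by (rule joining_mismatches_Markov)
  also have "\<dots> \<le> e" using \<xi>0 \<open>0 < e\<close> by (simp add: divide_simps power2_eq_square)
  finally show ?thesis .
qed

text \<open>
  Swapping the two components turns joinings of \<open>\<mu>\<close> and \<open>\<nu>\<close> into joinings of \<open>\<nu>\<close> and \<open>\<mu>\<close>.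
\<close>

lemma dbar_M_commute: "dbar_M \<mu> \<nu> = dbar_M \<nu> \<mu>"
proof -
  have le: "dbar_M \<nu> \<mu> \<le> dbar_M \<mu> \<nu>" for \<mu> \<nu> :: "(nat \<Rightarrow> 'a) measure"
    unfolding dbar_M_def
  proof (rule INF_mono)
    fix \<xi> :: "((nat \<Rightarrow> 'a) \<times> (nat \<Rightarrow> 'a)) measure" assume \<xi>: "\<xi> \<in> joinings \<mu> \<nu>"
    then have inv: "distr \<xi> borel (map_prod shift_map shift_map) = \<xi>"
      and fst: "distr \<xi> borel fst = \<mu>" and snd: "distr \<xi> borel snd = \<nu>"
      and sets: "sets \<xi> = sets borel"
      by (auto simp: joinings_def invariant_measures_def)
    interpret prob_space \<xi> using \<xi> by (simp add: joinings_def invariant_measures_def)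
    have space: "space \<xi> = UNIV" using sets_eq_imp_space_eq[OF sets] by simp
    let ?T = "map_prod shift_map shift_map :: (nat \<Rightarrow> 'a) \<times> (nat \<Rightarrow> 'a) \<Rightarrow> _"
    let ?S = "prod.swap :: (nat \<Rightarrow> 'a) \<times> (nat \<Rightarrow> 'a) \<Rightarrow> _"
    have T: "?T \<in> borel_measurable borel"
      by (intro borel_measurable_continuous_onI continuous_on_map_prod_shift)
    have S: "?S \<in> borel_measurable borel"
      by (intro borel_measurable_continuous_onI continuous_on_swap)
    have fs: "(fst :: (nat \<Rightarrow> 'a) \<times> (nat \<Rightarrow> 'a) \<Rightarrow> _) \<in> borel_measurable borel"
      "(snd :: (nat \<Rightarrow> 'a) \<times> (nat \<Rightarrow> 'a) \<Rightarrow> _) \<in> borel_measurable borel"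
      by (intro borel_measurable_continuous_onI continuous_intros)+
    have S\<xi>: "?S \<in> measurable \<xi> borel" and T\<xi>: "?T \<in> measurable \<xi> borel"
      using S T by (simp_all add: measurable_cong_sets[OF sets refl])
    have comm: "?T \<circ> ?S = ?S \<circ> ?T" "fst \<circ> ?S = snd" "snd \<circ> ?S = fst" by auto
    have "distr (distr \<xi> borel ?S) borel ?T = distr (distr \<xi> borel ?T) borel ?S"
      using S T S\<xi> T\<xi> by (simp add: distr_distr comm)
    then have "distr \<xi> borel ?S \<in> joinings \<nu> \<mu>"
      using fs S\<xi> prob_space_distr[OF S\<xi>]
      by (simp add: joinings_def invariant_measures_def distr_distr comm inv fst snd)
    moreover have "measure (distr \<xi> borel ?S) {(x, y). x 0 \<noteq> y 0} = measure \<xi> {(x, y). x 0 \<noteq> y 0}"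
    proof -
      have "{(x, y). x 0 \<noteq> y 0} \<in> sets (borel :: ((nat \<Rightarrow> 'a) \<times> (nat \<Rightarrow> 'a)) measure)"
        by (simp add: case_prod_unfold borel_mismatch)
      then have "measure (distr \<xi> borel ?S) {(x, y). x 0 \<noteq> y 0} =
          measure \<xi> (?S -` {(x, y). x 0 \<noteq> y 0})"
        by (simp add: measure_distr[OF S\<xi>] space)
      also have "?S -` {(x, y). x 0 \<noteq> y 0} = {(x, y). x 0 \<noteq> y 0}" by auto
      finally show ?thesis .
    qed
    ultimately show "\<exists>\<zeta>\<in>joinings \<nu> \<mu>. ereal (measure \<zeta> {(x, y). x 0 \<noteq> y 0}) \<le>
        ereal (measure \<xi> {(x, y). x 0 \<noteq> y 0})"
      by (intro bexI[where x = "distr \<xi> borel ?S"]) simp_all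
  qed
  show ?thesis by (rule antisym) (rule le)+
qed

section \<open>The pointwise pseudometric and concatenations\<close>

lemma dbar_eq_mismatches: "dbar x y = limsup (\<lambda>n. ereal (real (mismatches x y n) / real n))"
  by (simp add: dbar_def mismatches_def)

lemma dbar_commute: "dbar x y = dbar y x"
  by (simp add: dbar_eq_mismatches mismatches_commute)

lemma dbar_leI:
  assumes "\<forall>\<^sub>F n in sequentially. real (mismatches x y n) / real n \<le> c"
  shows "dbar x y \<le> ereal c"
  unfolding dbar_eq_mismatches using assms by (intro Limsup_bounded) simp

lemma dbar_le_1: "dbar x y \<le> 1"
  using dbar_leI[of x y 1] mismatches_le[of x y] by (simp add: divide_simps one_ereal_def)

lemma dbar_triangle: "dbar x z \<le> dbar x y + dbar y z"
proof -
  have "real (mismatches x z n) / real n \<le>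
      real (mismatches x y n) / real n + real (mismatches y z n) / real n" for n
    using mismatches_triangle[of x z n y]
    by (simp add: divide_right_mono flip: add_divide_distrib of_nat_add)
  then have "dbar x z \<le> limsup (\<lambda>n. ereal (real (mismatches x y n) / real n) +
      ereal (real (mismatches y z n) / real n))"
    unfolding dbar_eq_mismatches by (intro Limsup_mono) simp
  also have "\<dots> \<le> dbar x y + dbar y z"
    unfolding dbar_eq_mismatches by (rule ereal_limsup_add_mono)
  finally show ?thesis .
qed

lemma infinite_concat_blocks:
  assumes s: "strict_mono s" "s 0 = 0"
  shows "infinite_concat (\<lambda>j. map z [s j..<s (Suc j)]) = z"
proof
  fix k
  have "concat (map (\<lambda>j. map z [s j..<s (Suc j)]) [0..<m]) = map z [0..<s m]" for m
  proof (induction m)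
    case (Suc m)
    have "s m \<le> s (Suc m)" using s(1) by (simp add: strict_mono_less_eq)
    then have "[0..<s (Suc m)] = [0..<s m] @ [s m..<s (Suc m)]"
      using upt_add_eq_append[of 0 "s m" "s (Suc m) - s m"] by simp
    then show ?case using Suc.IH by simp
  qed (simp add: s(2))
  moreover have "k < s (Suc k)"
    using strict_mono_imp_increasing[OF s(1), of "Suc k"] by linarith
  ultimately show "infinite_concat (\<lambda>j. map z [s j..<s (Suc j)]) k = z k"
    by (simp only: infinite_concat_def) simp
qed

section \<open>Greedy pasting of blocks\<close>

text \<open>
  The greedy parsing, as the start of the block in force at time \<open>t\<close>: a new block begins at the
  first time in \<open>G\<close> that leaves room for \<open>n\<close> letters of the current one. Position \<open>0\<close> starts a block
  even if it is not in \<open>G\<close>; this spoils at most \<open>n\<close> letters.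
\<close>

fun block_start :: "nat \<Rightarrow> nat set \<Rightarrow> nat \<Rightarrow> nat" where
  "block_start n G 0 = 0"
| "block_start n G (Suc t) =
    (if block_start n G t + n \<le> Suc t \<and> Suc t \<in> G then Suc t else block_start n G t)"

definition paste :: "nat \<Rightarrow> nat set \<Rightarrow> (nat \<Rightarrow> nat \<Rightarrow> 'a) \<Rightarrow> nat \<Rightarrow> 'a" where
  "paste n G y t = y (block_start n G t) (t - block_start n G t)"

lemma block_start_le: "block_start n G t \<le> t"
  by (induction t) auto

lemma block_start_idem: "block_start n G (block_start n G t) = block_start n G t"
  by (induction t) auto

lemma block_start_mono: "t \<le> t' \<Longrightarrow> block_start n G t \<le> block_start n G t'"
  by (induction rule: dec_induct) (auto simp: block_start_le le_Suc_eq intro: order_trans)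

lemma block_start_in: "block_start n G t = 0 \<or> block_start n G t \<in> G"
  by (induction t) auto

text \<open>
  Beyond the first \<open>n\<close> letters a block goes on only because no position of \<open>G\<close> has been met; the skipped
  positions can therefore be charged to the complement of \<open>G\<close>.
\<close>

lemma not_good_after_block:
  assumes "0 < n" "block_start n G t + n \<le> t"
  shows "t \<notin> G"
  using assms by (cases t) (auto split: if_splits)

lemma infinite_block_starts:
  assumes "infinite G"
  shows "infinite {t. block_start n G t = t}"
proof
  assume "finite {t. block_start n G t = t}"
  then obtain m where m: "\<And>t. block_start n G t = t \<Longrightarrow> t \<le> m"
    by (auto simp: finite_nat_set_iff_bounded_le)
  obtain g where g: "g \<in> G" "Suc (m + n) \<le> g"
    using assms by (auto simp: infinite_nat_iff_unbounded_le)
  then obtain t where t: "g = Suc t" by (cases g) auto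
  have "block_start n G t \<le> m" by (rule m) (rule block_start_idem)
  then have "block_start n G g = g" using g t by simp
  then show False using m g(2) by fastforce
qed

text \<open>
  The words to be concatenated are the prefixes of the \<open>y p\<close> between consecutive block starts \<open>p\<close>,
  enumerated by \<open>s\<close>. Each covers its block and the skipped positions after it, so all words have
  length at least \<open>n\<close>.
\<close>

lemma paste_eq_infinite_concat:
  assumes "0 < n" and "infinite G"
  obtains s where "infinite_concat (\<lambda>j. map (y (s j)) [0..<s (Suc j) - s j]) = paste n G y"
    and "\<forall>j. s j + n \<le> s (Suc j)"
proof -
  define S where "S = {t. block_start n G t = t}"
  define s where "s = enumerate S"
  have S: "infinite S" unfolding S_def using assms(2) by (rule infinite_block_starts)
  have s: "strict_mono s" unfolding s_def by (rule strict_mono_enumerate[OF S])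
  have s_in: "block_start n G (s j) = s j" for j
    using enumerate_in_set[OF S, of j] by (simp add: s_def S_def)
  have s0: "s 0 = 0" by (simp add: s_def enumerate_0 S_def)
  have between: "block_start n G t = s j" if "s j \<le> t" "t < s (Suc j)" for j t
  proof (rule ccontr)
    assume ne: "block_start n G t \<noteq> s j"
    have "s j \<le> block_start n G t"
      using block_start_mono[OF that(1), of n G] by (simp add: s_in)
    then have "enumerate S j < block_start n G t" using ne by (simp add: s_def)
    moreover have "block_start n G t \<in> S" by (simp add: S_def block_start_idem)
    ultimately have "s (Suc j) \<le> block_start n G t"
      unfolding s_def enumerate_Suc''[OF S] by (intro Least_le) simp
    then show False using that(2) block_start_le[of n G t] by linarith
  qed
  have "map (y (s j)) [0..<s (Suc j) - s j] = map (paste n G y) [s j..<s (Suc j)]" for j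
  proof (rule nth_equalityI)
    fix i assume "i < length (map (y (s j)) [0..<s (Suc j) - s j])"
    then show "map (y (s j)) [0..<s (Suc j) - s j] ! i = map (paste n G y) [s j..<s (Suc j)] ! i"
      using between[of j "s j + i"] by (simp add: paste_def)
  qed simp
  then have "infinite_concat (\<lambda>j. map (y (s j)) [0..<s (Suc j) - s j]) = paste n G y"
    using infinite_concat_blocks[OF s s0, of "paste n G y"] by simp
  moreover have "s j + n \<le> s (Suc j)" for j
  proof -
    have less: "s j < s (Suc j)" using s by (simp add: strict_mono_less)
    then obtain t where t: "s (Suc j) = Suc t" by (cases "s (Suc j)") auto
    have "block_start n G t = s j" using less t by (intro between) auto
    then show ?thesis
      using s_in[of "Suc j"] less t by (auto split: if_splits)
  qed
  ultimately show thesis using that by blast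
qed

text \<open>
  Induction over time, keeping account of the current block. A finished block has at most \<open>e n\<close>
  mismatches and occupies at least \<open>n\<close> positions, so the finished blocks cost at most \<open>e\<close> times the
  start of the current one; a skipped position is charged to the first sum. The term \<open>2 n\<close> covers the
  block at \<open>0\<close>, which need not match, and the unfinished current block.
\<close>

lemma mismatches_paste:
  assumes "0 < n" "0 \<le> e"
    and close: "\<And>p. p \<in> G \<Longrightarrow> real (mismatches (\<lambda>j. x (p + j)) (y p) n) \<le> e * real n"
  shows "real (mismatches x (paste n G y) T) \<le>
    real (\<Sum>t<T. of_bool (t \<notin> G)) + e * real T + 2 * real n"
proof -
  define c where "c = block_start n G"
  define E where "E p k = real (mismatches (\<lambda>j. x (p + j)) (y p) k)" for p k
  \<comment> \<open>The cost of the initial block, which is booked once that block is finished.\<close>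
  define K where "K p = (if p = 0 then 0 else real n)" for p :: nat
  have E_le: "E p n \<le> real n" for p unfolding E_def using mismatches_le by simp
  have "real (mismatches x (paste n G y) T) \<le>
      real (\<Sum>t<T. of_bool (t \<notin> G)) + e * real (c T) + K (c T) + E (c T) (min n (T - c T))"
  proof (induction T)
    case 0
    then show ?case by (simp add: E_def K_def c_def)
  next
    case (Suc T)
    have cT: "c T \<le> T" unfolding c_def by (rule block_start_le)
    have z: "paste n G y T = y (c T) (T - c T)" by (simp add: paste_def c_def)
    have step: "real (mismatches x (paste n G y) (Suc T)) \<le>
        real (\<Sum>t<Suc T. of_bool (t \<notin> G)) + e * real (c T) + K (c T) +
        E (c T) (min n (Suc T - c T))"
    proof (cases "T - c T < n")
      case True
      then have "min n (Suc T - c T) = Suc (T - c T)" "min n (T - c T) = T - c T"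
        using cT by auto
      moreover have "E (c T) (Suc (T - c T)) = E (c T) (T - c T) + of_bool (x T \<noteq> paste n G y T)"
        using cT by (simp add: E_def mismatches_Suc z)
      ultimately show ?thesis using Suc.IH by (simp add: mismatches_Suc)
    next
      case False
      then have "T \<notin> G" using not_good_after_block[OF assms(1), of G T] cT by (simp add: c_def)
      moreover have "min n (Suc T - c T) = n" "min n (T - c T) = n" using False by auto
      ultimately show ?thesis using Suc.IH by (simp add: mismatches_Suc)
    qed
    show ?case
    proof (cases "c T + n \<le> Suc T \<and> Suc T \<in> G")
      case True
      then have c': "c (Suc T) = Suc T" by (simp add: c_def)
      have "e * real n + e * real (c T) \<le> e * real (Suc T)"
        using True assms(2) by (simp add: mult_left_mono flip: distrib_left of_nat_add)
      moreover have "K (c T) + E (c T) n \<le> real n + e * real n"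
      proof (cases "c T = 0")
        case True
        then show ?thesis using E_le[of "c T"] assms(2) by (simp add: K_def add_increasing2)
      next
        case False
        then have "E (c T) n \<le> e * real n"
          unfolding E_def using block_start_in[of n G T] by (intro close) (simp add: c_def)
        then show ?thesis using False by (simp add: K_def)
      qed
      moreover have "min n (Suc T - c T) = n" using True by auto
      moreover have "E (Suc T) (min n (Suc T - Suc T)) = 0" by (simp add: E_def)
      ultimately show ?thesis using step unfolding c' by (simp add: K_def)
    next
      case False
      then have "c (Suc T) = c T" by (auto simp: c_def)
      then show ?thesis using step by simp
    qed
  qed
  moreover have "e * real (c T) \<le> e * real T"
    using assms(2) block_start_le[of n G T] by (simp add: c_def mult_left_mono)
  moreover have "K (c T) \<le> real n" by (simp add: K_def)
  moreover have "E (c T) (min n (T - c T)) \<le> real n"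
    unfolding E_def using mismatches_le[of _ _ "min n (T - c T)"]
    by (metis min.bounded_iff of_nat_le_iff)
  ultimately show ?thesis by linarith
qed

section \<open>Approximation by points of a shadowing shift space\<close>

text \<open>
  Of the distance \<open>5 e\<close>, the positions outside \<open>G\<close> account for \<open>2 e\<close>, the blocks for \<open>e\<close>, the vanishing
  term \<open>2 n / T\<close> for \<open>e\<close>, and shadowing for \<open>e\<close>.
\<close>

lemma shadowing_approximates:
  fixes X Y :: "(nat \<Rightarrow> 'a::finite_alphabet) set"
  assumes X: "shift_space X" "x \<in> X" and Y: "shift_space Y" "dbar_shadowing Y" and "0 < e"
    and close: "\<And>\<mu>. \<mu> \<in> shift_measures_on X \<Longrightarrow> \<exists>\<nu>\<in>shift_measures_on Y. dbar_M \<mu> \<nu> < ereal (e\<^sup>2)"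
  shows "\<exists>y\<in>Y. dbar x y \<le> ereal (5 * e)"
proof (cases "e < 1 / 2")
  case False
  obtain y where "y \<in> Y" using Y(1) by (auto simp: shift_space_def)
  moreover have "dbar x y \<le> ereal (5 * e)"
    using dbar_le_1[of x y] False by (elim order_trans) simp
  ultimately show ?thesis by blast
next
  case True
  have clY: "closed Y" and neY: "Y \<noteq> {}" using Y(1) by (auto simp: shift_space_def)
  obtain n where "1 \<le> n" and shadow: "\<And>w. \<forall>j. w j \<in> language Y \<and> n \<le> length (w j) \<Longrightarrow>
      \<exists>x'\<in>Y. dbar (infinite_concat w) x' < ereal e"
    using Y(2) \<open>0 < e\<close> unfolding dbar_shadowing_def by metis
  then have n: "0 < n" by simp
  define U where "U = unmatched Y e n"
  define G where "G = {t. (\<lambda>j. x (t + j)) \<notin> U}"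
  have small: "measure \<mu> U \<le> e" if "\<mu> \<in> shift_measures_on X" for \<mu>
    using close[OF that] measure_unmatched_le[OF clY _ _ \<open>0 < e\<close> n] unfolding U_def by blast
  have freq: "\<forall>\<^sub>F T in sequentially. visit_freq x U T \<le> 2 * e"
  proof (rule ccontr)
    assume "\<not> ?thesis"
    then have "\<exists>\<^sub>F T in sequentially. 2 * e \<le> visit_freq x U T"
      unfolding not_eventually by (rule frequently_elim1) simp
    then obtain \<mu> where "\<mu> \<in> shift_measures_on X" "2 * e \<le> measure \<mu> U"
      unfolding U_def by (rule invariant_measure_with_visit_freq[OF X clopen_unmatched])
    then show False using small \<open>0 < e\<close> by fastforce
  qed
  have sum_U: "(\<Sum>t<T. indicat_real U (\<lambda>j. x (t + j))) = real (\<Sum>t<T. of_bool (t \<notin> G))" for T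
    by (auto simp: G_def indicator_def intro!: sum.cong)
  \<comment> \<open>Otherwise almost all positions would be unmatched, with frequency tending to \<open>1 > 2 e\<close>.\<close>
  have inf: "infinite G"
  proof
    assume "finite G"
    then obtain k where k: "\<And>t. t \<in> G \<Longrightarrow> t < k" by (auto simp: finite_nat_set_iff_bounded)
    have count: "T \<le> (\<Sum>t<T. of_bool (t \<notin> G)) + k" for T
    proof (induction T)
      case (Suc T)
      have "T < k" if "T \<in> G" using k that .
      then show ?case using Suc.IH k by (cases "T < k") auto
    qed simp
    have "(\<lambda>T. real k / real T) \<longlonglongrightarrow> 0" by (rule lim_const_over_n)
    then have "\<forall>\<^sub>F T in sequentially. real k / real T < 1 - 2 * e"
      using True by (intro order_tendstoD) auto
    then have "\<forall>\<^sub>F T in sequentially. False"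
      using freq eventually_gt_at_top[of 0]
    proof eventually_elim
      case (elim T)
      have "real T \<le> visit_freq x U T * real T + real k"
        using count[of T] elim(3) unfolding visit_freq_def sum_U by (simp flip: of_nat_add)
      also have "\<dots> \<le> 2 * e * real T + real k" using elim(2) by (simp add: mult_right_mono)
      finally show False using elim(1,3) by (simp add: field_simps)
    qed
    then show False by simp
  qed
  \<comment> \<open>At other positions any point of \<open>Y\<close> will do; it is used only for a block at \<open>0\<close>.\<close>
  have "\<exists>y. y \<in> Y \<and> (t \<in> G \<longrightarrow> real (mismatches (\<lambda>j. x (t + j)) y n) \<le> e * real n)" for t
    using neY by (auto simp: G_def U_def unmatched_def not_less)
  then obtain y where yY: "\<And>t. y t \<in> Y"
    and y_close: "\<And>t. t \<in> G \<Longrightarrow> real (mismatches (\<lambda>j. x (t + j)) (y t) n) \<le> e * real n"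
    by metis
  define z where "z = paste n G y"
  have xz: "dbar x z \<le> ereal (4 * e)"
  proof (rule dbar_leI)
    have "(\<lambda>T. 2 * real n / real T) \<longlonglongrightarrow> 0" by (rule lim_const_over_n)
    then have "\<forall>\<^sub>F T in sequentially. 2 * real n / real T < e"
      using \<open>0 < e\<close> by (rule order_tendstoD)
    then show "\<forall>\<^sub>F T in sequentially. real (mismatches x z T) / real T \<le> 4 * e"
      using freq eventually_gt_at_top[of 0]
    proof eventually_elim
      case (elim T)
      have "real (mismatches x z T) \<le> (\<Sum>t<T. indicat_real U (\<lambda>j. x (t + j))) + e * real T + 2 * real n"
        unfolding z_def sum_U using \<open>0 < e\<close> by (intro mismatches_paste n y_close) auto
      then have "real (mismatches x z T) / real T \<le> visit_freq x U T + e + 2 * real n / real T"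
        using elim(3) unfolding visit_freq_def by (simp add: field_simps)
      then show ?case using elim(1,2) by linarith
    qed
  qed
  obtain s where s: "infinite_concat (\<lambda>j. map (y (s j)) [0..<s (Suc j) - s j]) = z"
    "\<forall>j. s j + n \<le> s (Suc j)"
    unfolding z_def by (rule paste_eq_infinite_concat[OF n inf])
  have "map (y t) [0..<k] \<in> language Y" for t k
    unfolding language_def using yY[of t]
    by (intro CollectI exI[of _ "y t"] exI[of _ 0] exI[of _ k]) simp
  moreover have "n \<le> s (Suc j) - s j" for j
    using s(2)[rule_format, of j] by simp
  ultimately have "\<exists>y'\<in>Y. dbar z y' < ereal e"
    unfolding s(1)[symmetric] by (intro shadow) simp
  then obtain y' where y': "y' \<in> Y" "dbar z y' < ereal e" ..
  have "dbar x y' \<le> ereal (4 * e) + ereal e"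
    using dbar_triangle[of x y' z] add_mono[OF xz less_imp_le[OF y'(2)]] by (rule order_trans)
  then show ?thesis using y'(1) by auto
qed

theorem theorem12:
  fixes X Y :: "(nat \<Rightarrow> 'a::finite_alphabet) set" and \<epsilon> :: real
  assumes "2 \<le> CARD('a)"
    and "shift_space X" and "shift_space Y"
    and "dbar_shadowing X" and "dbar_shadowing Y"
    and "0 < \<epsilon>"
    and "hausdorff dbar_M (shift_measures_on X) (shift_measures_on Y) < ereal (\<epsilon>\<^sup>2)"
  shows "hausdorff dbar X Y < ereal (7 * \<epsilon>)"
proof -
  have XY: "\<exists>\<nu>\<in>shift_measures_on Y. dbar_M \<mu> \<nu> < ereal (\<epsilon>\<^sup>2)"
    if "\<mu> \<in> shift_measures_on X" for \<mu>
    using assms(7) SUP_lessD[OF _ that, of "\<lambda>\<mu>. INF \<nu>\<in>shift_measures_on Y. dbar_M \<mu> \<nu>"]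
    by (simp add: hausdorff_def INF_less_iff)
  have YX: "\<exists>\<mu>\<in>shift_measures_on X. dbar_M \<nu> \<mu> < ereal (\<epsilon>\<^sup>2)"
    if "\<nu> \<in> shift_measures_on Y" for \<nu>
    using assms(7) SUP_lessD[OF _ that, of "\<lambda>\<nu>. INF \<mu>\<in>shift_measures_on X. dbar_M \<mu> \<nu>"]
    by (simp add: hausdorff_def INF_less_iff dbar_M_commute[of \<nu>])
  have "(INF y\<in>Y. dbar x y) \<le> ereal (5 * \<epsilon>)" if "x \<in> X" for x
    using shadowing_approximates[OF assms(2) that assms(3,5,6) XY] by (meson INF_lower2)
  moreover have "(INF x\<in>X. dbar x y) \<le> ereal (5 * \<epsilon>)" if "y \<in> Y" for y
    using shadowing_approximates[OF assms(3) that assms(2,4,6) YX]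
    by (auto intro: INF_lower2 simp: dbar_commute[of _ y])
  ultimately have "hausdorff dbar X Y \<le> ereal (5 * \<epsilon>)"
    by (simp add: hausdorff_def SUP_le_iff)
  also have "\<dots> < ereal (7 * \<epsilon>)" using assms(6) by simp
  finally show ?thesis .
qed

end
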